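(* Let $\mathbb{F}$ be a field with algebraic closure $\overline{\mathbb{F}}$, let $k\ge1$, and let $$P(\lambda)=\sum_{i=0}^{k-1}(A_i-\lambda B_i)p_i(\lambda)\in\mathbb{F}[\lambda]^{p\times m},$$ where $A_i,B_i\in\mathbb{F}^{p\times m}$ and $p_0(\lambda),\dots,p_{k-1}(\lambda)\in\mathbb{F}[\lambda]$ are scalar polynomials with $p_0(\lambda)\equiv1$. Set $p(\lambda):=[p_{k-1}(\lambda)\ \cdots\ p_0(\lambda)]^T$ and assume that $(X-\lambda Y)p(\lambda)=0$, where $X,Y\in\mathbb{F}^{(k-1)\times k}$ satisfy $\operatorname{rank}(X-\lambda_0Y)=k-1$ for all $\lambda_0\in\overline{\mathbb{F}}$. Consider the pencil $$C(\lambda)=\begin{bmatrix}A_{k-1}-\lambda B_{k-1}\ \cdots\ A_0-\lambda B_0\\ (X-\lambda Y)\otimes I_m\end{bmatrix}$$ with the partition $$C(\lambda)=\left[\begin{array}{c|c}A_{k-1}-\lambda B_{k-1}\ \cdots\ A_1-\lambda B_1&A_0-\lambda B_0\\ \hline X_1(\lambda)&X_2(\lambda)\end{array}\right],$$ where $(X-\lambda Y)\otimes I_m=:\begin{bmatrix}X_1(\lambda)&X_2(\lambda)\end{bmatrix}$ and $X_1(\lambda)$ has size $(k-1)m\times(k-1)m$. Then $C(\lambda)$ is a linear polynomial system matrix with state matrix $X_1(\lambda)$ and transfer function matrix $P(\lambda)$. In addition, $X_1(\lambda)$ is unimodular.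
   Context: $\mathbb{F}$ is an arbitrary field. A pencil is a polynomial matrix of degree at most $1$. A square polynomial matrix is regular if its determinant is not identically zero, and unimodular if its determinant is a nonzero constant. $\otimes$ is the Kronecker product. A polynomial system matrix with state matrix $A(\lambda)$ is a polynomial matrix which has, up to the position of the blocks, the form $\begin{bmatrix}A(\lambda)&B(\lambda)\\ -C(\lambda)&D(\lambda)\end{bmatrix}$ with $A(\lambda)$ square and regular; its transfer function matrix is the Schur complement of $A(\lambda)$, i.e. $D(\lambda)+C(\lambda)A(\lambda)^{-1}B(\lambda)$. The state matrix may be located anywhere in the matrix; for a partition $\begin{bmatrix}-C(\lambda)&D(\lambda)\\ A(\lambda)&B(\lambda)\end{bmatrix}$ with state matrix $A(\lambda)$ the transfer function matrix is likewise $D(\lambda)+C(\lambda)A(\lambda)^{-1}B(\lambda)$. It is linear if it is a pencil. When $k=1$ the blocks with $k-1=0$ rows or columns are empty. *)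

theory Defs
  imports
    "Jordan_Normal_Form.DL_Rank"
    "Jordan_Normal_Form.Determinant"
    "Jordan_Normal_Form.Gauss_Jordan_Elimination"
    "HOL-Computational_Algebra.Polynomial_Factorial"
    "HOL-Algebra.Algebraic_Closure_Type"
begin

text \<open>Frees the letter \<open>X\<close>, which HOL-Algebra reserves as notation for a univariate polynomial.\<close>

no_notation var (\<open>X\<index>\<close>)

text \<open>Matrices are those of \<open>Jordan_Normal_Form.Matrix\<close>; dimensions may be zero, so that the
  blocks with \<open>k - 1 = 0\<close> rows or columns are covered. The rational functions are the
  fraction field \<open>'a poly fract\<close>.\<close>

definition is_pencil :: "'a :: zero poly mat \<Rightarrow> bool" where
  "is_pencil M \<longleftrightarrow> (\<forall>i < dim_row M. \<forall>j < dim_col M. Polynomial.degree (M $$ (i, j)) \<le> 1)"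

definition regular_poly_mat :: "'a :: comm_ring_1 poly mat \<Rightarrow> bool" where
  "regular_poly_mat M \<longleftrightarrow> square_mat M \<and> det M \<noteq> 0"

definition unimodular_poly_mat :: "'a :: comm_ring_1 poly mat \<Rightarrow> bool" where
  "unimodular_poly_mat M \<longleftrightarrow> square_mat M \<and> (\<exists>c. c \<noteq> 0 \<and> det M = [:c:])"

text \<open>The pencil \<open>A - \<lambda> B\<close>, the indeterminate \<open>\<lambda>\<close> being \<open>[:0, 1:]\<close>.\<close>

definition pencil :: "'a :: comm_ring_1 mat \<Rightarrow> 'a mat \<Rightarrow> 'a poly mat" where
  "pencil A B = map_mat (\<lambda>a. [:a:]) A - [:0, 1:] \<cdot>\<^sub>m map_mat (\<lambda>b. [:b:]) B"

definition kronecker :: "'a :: times mat \<Rightarrow> 'a mat \<Rightarrow> 'a mat" where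
  "kronecker A B = mat (dim_row A * dim_row B) (dim_col A * dim_col B)
     (\<lambda>(i, j). A $$ (i div dim_row B, j div dim_col B) * B $$ (i mod dim_row B, j mod dim_col B))"

definition append_cols :: "'a :: zero mat \<Rightarrow> 'a mat \<Rightarrow> 'a mat" where
  "append_cols A B = four_block_mat A B (0\<^sub>m 0 (dim_col A)) (0\<^sub>m 0 (dim_col B))"

text \<open>The block row \<open>[M (n-1) \<dots> M 0]\<close> of \<open>n\<close> blocks of size \<open>p \<times> m\<close>, in descending order.\<close>

definition block_row_desc :: "nat \<Rightarrow> nat \<Rightarrow> nat \<Rightarrow> (nat \<Rightarrow> 'a mat) \<Rightarrow> 'a mat" where
  "block_row_desc p m n M = mat p (n * m) (\<lambda>(i, j). M (n - 1 - j div m) $$ (i, j mod m))"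

text \<open>\<open>poly_system_matrix M A B C D\<close>: up to the position of the blocks, \<open>M\<close> is
  \<open>[A, B; -C, D]\<close> with regular state matrix \<open>A\<close>. The blocks are explicit arguments because
  the matrix \<open>M\<close> alone determines neither the state matrix nor the transfer function.\<close>

definition poly_system_matrix ::
    "'a :: field poly mat \<Rightarrow> 'a poly mat \<Rightarrow> 'a poly mat \<Rightarrow> 'a poly mat \<Rightarrow> 'a poly mat \<Rightarrow> bool" where
  "poly_system_matrix M A B C D \<longleftrightarrow>
     regular_poly_mat A \<and>
     dim_row B = dim_row A \<and> dim_col C = dim_col A \<and>
     dim_row D = dim_row C \<and> dim_col D = dim_col B \<and>
     M \<in> {four_block_mat A B (- C) D, four_block_mat (- C) D A B,
          four_block_mat B A D (- C), four_block_mat D (- C) B A}"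

definition linear_system_matrix ::
    "'a :: field poly mat \<Rightarrow> 'a poly mat \<Rightarrow> 'a poly mat \<Rightarrow> 'a poly mat \<Rightarrow> 'a poly mat \<Rightarrow> bool" where
  "linear_system_matrix M A B C D \<longleftrightarrow> poly_system_matrix M A B C D \<and> is_pencil M"

abbreviation rat_mat :: "'a :: field poly mat \<Rightarrow> 'a poly fract mat" where
  "rat_mat \<equiv> map_mat to_fract"

text \<open>For regular \<open>A\<close> the inverse exists over the fraction field, so there \<open>the\<close> is never applied to \<open>None\<close>. The Schur
  complement of \<open>A\<close> carries a plus sign because the off-diagonal block of the matrix is \<open>- C\<close>.\<close>

definition transfer_function ::
    "'a :: field poly mat \<Rightarrow> 'a poly mat \<Rightarrow> 'a poly mat \<Rightarrow> 'a poly mat \<Rightarrow> 'a poly fract mat" where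
  "transfer_function A B C D =
     rat_mat D + rat_mat C * the (mat_inverse (rat_mat A)) * rat_mat B"

end

theory Submission
  imports Defs "Jordan_Normal_Form.Char_Poly"
begin

text \<open>
  Write \<open>n = k - 1\<close> and split the pencil \<open>L = X - \<lambda>Y\<close> as \<open>[L1 | l]\<close> with \<open>L1\<close> square. Since
  \<open>q\<^sub>0 = 1\<close>, the relation \<open>L [q\<^sub>n, \<dots>, q\<^sub>0]\<^sup>T = 0\<close> says that the last column depends on the others with polynomial
  coefficients: \<open>l = - L1 v\<close>, where \<open>v = [q\<^sub>n, \<dots>, q\<^sub>1]\<^sup>T\<close>. This single relation gives both claims.

  Unimodularity: if \<open>det L1\<close> vanished at a point \<open>z\<close> of the algebraic closure, a nonzero row vector
  annihilating \<open>L1(z)\<close> would also annihilate \<open>l(z) = - L1(z) v(z)\<close>, hence all of \<open>L(z)\<close>, which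
  contradicts full row rank (\<open>det_leading_block_constant\<close>). A polynomial without zeros in the
  closure is a nonzero constant. The state matrix is \<open>X1 = L1 \<otimes> I\<close>, and the mixed product rule
  applied to \<open>L1\<close> and its adjugate shows that \<open>det X1\<close> divides a power of \<open>det L1\<close>
  (\<open>det_kronecker_one_dvd\<close>), so it is a nonzero constant too.

  Transfer function: tensoring \<open>l = - L1 v\<close> with \<open>I\<close> gives \<open>X2 = - X1 Q\<close> for \<open>Q = v \<otimes> I\<close>. Thus
  \<open>X1\<^sup>-\<^sup>1 X2 = - Q\<close> needs no computation of an inverse
  (\<open>transfer_function_eq_if_solution\<close>), and the Schur complement \<open>D - N X1\<^sup>-\<^sup>1 X2 = D + N Q\<close> is the
  block row \<open>[N | D]\<close> applied to \<open>[q\<^sub>n, \<dots>, q\<^sub>0]\<^sup>T \<otimes> I\<close>, which is \<open>P\<close>.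
\<close>

section \<open>Kronecker products\<close>

text \<open>The pairs \<open>(l div m, l mod m)\<close> run through all of \<open>{..<n} \<times> {..<m}\<close>; every sum over the
  inner index of a product of Kronecker-structured matrices is turned into a double sum in this way.\<close>

lemma sum_div_mod:
  fixes f :: "nat \<Rightarrow> nat \<Rightarrow> 'a :: comm_monoid_add"
  shows "(\<Sum>l<n * m. f (l div m) (l mod m)) = (\<Sum>a<n. \<Sum>b<m. f a b)"
proof -
  have inner: "(\<Sum>l\<in>{a * m..<a * m + m}. f (l div m) (l mod m)) = (\<Sum>b<m. f a b)" for a
    by (rule sum.reindex_bij_witness[of _ "\<lambda>b. a * m + b" "\<lambda>l. l - a * m"])
       (auto simp: less_diff_conv2 div_nat_eqI mod_nat_eqI ac_simps dest!: le_Suc_ex)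
  show ?thesis
    unfolding sum.nat_group[symmetric] inner ..
qed

lemma kronecker_carrier [simp, intro]:
  "A \<in> carrier_mat r c \<Longrightarrow> B \<in> carrier_mat r' c' \<Longrightarrow>
   kronecker A B \<in> carrier_mat (r * r') (c * c')"
  by (auto simp: kronecker_def)

lemma div_mod_less:
  fixes i r m :: nat
  assumes "i < r * m"
  shows "i div m < r" "i mod m < m"
  using assms by (auto simp: less_mult_imp_div_less intro!: mod_less_divisor Nat.gr0I)

text \<open>The mixed product rule: the double sum over the inner index factors.\<close>

lemma kronecker_mult:
  fixes A B C D :: "'a :: comm_semiring_0 mat"
  assumes A: "A \<in> carrier_mat r n" and B: "B \<in> carrier_mat r' m"
    and C: "C \<in> carrier_mat n c" and D: "D \<in> carrier_mat m c'"
  shows "kronecker A B * kronecker C D = kronecker (A * C) (B * D)"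
proof (rule eq_matI)
  fix i j
  assume "i < dim_row (kronecker (A * C) (B * D))" "j < dim_col (kronecker (A * C) (B * D))"
  then have i: "i < r * r'" and j: "j < c * c'"
    using A B C D by (auto simp: kronecker_def)
  note bounds = div_mod_less[OF i] div_mod_less[OF j]
  have "(kronecker A B * kronecker C D) $$ (i, j) =
      (\<Sum>l<n * m. (A $$ (i div r', l div m) * B $$ (i mod r', l mod m)) *
                   (C $$ (l div m, j div c') * D $$ (l mod m, j mod c')))"
    using A B C D i j by (simp add: kronecker_def scalar_prod_def atLeast0LessThan)
  also have "\<dots> = (\<Sum>a<n. \<Sum>b<m. (A $$ (i div r', a) * B $$ (i mod r', b)) *
                   (C $$ (a, j div c') * D $$ (b, j mod c')))"
    by (rule sum_div_mod)
  also have "\<dots> = (\<Sum>a<n. A $$ (i div r', a) * C $$ (a, j div c')) *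
                  (\<Sum>b<m. B $$ (i mod r', b) * D $$ (b, j mod c'))"
    by (simp add: sum_product ac_simps)
  also have "\<dots> = kronecker (A * C) (B * D) $$ (i, j)"
    using A B C D i j bounds by (simp add: kronecker_def scalar_prod_def atLeast0LessThan)
  finally show "(kronecker A B * kronecker C D) $$ (i, j) = kronecker (A * C) (B * D) $$ (i, j)" .
qed (use A B C D in \<open>auto simp: kronecker_def\<close>)

lemma kronecker_scalar_one:
  "kronecker (d \<cdot>\<^sub>m 1\<^sub>m n) (1\<^sub>m m) = (d :: 'a :: comm_ring_1) \<cdot>\<^sub>m 1\<^sub>m (n * m)"
proof (rule eq_matI)
  fix i j assume "i < dim_row (d \<cdot>\<^sub>m 1\<^sub>m (n * m) :: 'a mat)" "j < dim_col (d \<cdot>\<^sub>m 1\<^sub>m (n * m) :: 'a mat)"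
  then have ij: "i < n * m" "j < n * m" by auto
  have "i div m = j div m \<and> i mod m = j mod m \<longleftrightarrow> i = j"
    by (metis div_mult_mod_eq)
  then show "kronecker (d \<cdot>\<^sub>m 1\<^sub>m n) (1\<^sub>m m) $$ (i, j) = (d \<cdot>\<^sub>m 1\<^sub>m (n * m)) $$ (i, j)"
    using ij div_mod_less[OF ij(1)] div_mod_less[OF ij(2)] by (auto simp: kronecker_def)
qed (auto simp: kronecker_def)

text \<open>Divisibility suffices for transferring unimodularity from \<open>A\<close> to \<open>A \<otimes> I\<close>. It follows from
  \<open>(A \<otimes> I) (adj A \<otimes> I) = det A \<cdot> I\<close> by taking determinants, without expanding the
  determinant of a Kronecker product.\<close>

lemma det_kronecker_one_dvd:
  fixes A :: "'a :: comm_ring_1 mat"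
  assumes A: "A \<in> carrier_mat n n"
  shows "det (kronecker A (1\<^sub>m m)) dvd det A ^ (n * m)"
proof -
  note adj = adj_mat[OF A]
  have "kronecker A (1\<^sub>m m) * kronecker (adj_mat A) (1\<^sub>m m) = det A \<cdot>\<^sub>m 1\<^sub>m (n * m)"
    using kronecker_mult[OF A one_carrier_mat adj(1) one_carrier_mat, of m]
    by (simp add: adj(2) kronecker_scalar_one)
  moreover have "det (kronecker A (1\<^sub>m m) * kronecker (adj_mat A) (1\<^sub>m m)) =
      det (kronecker A (1\<^sub>m m)) * det (kronecker (adj_mat A) (1\<^sub>m m))"
    by (rule det_mult[of _ "n * m"]) (use A adj(1) in auto)
  ultimately have "det A ^ (n * m) =
      det (kronecker A (1\<^sub>m m)) * det (kronecker (adj_mat A) (1\<^sub>m m))"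
    by (metis det_smult det_one index_one_mat(3) mult.right_neutral)
  then show ?thesis by simp
qed

section \<open>Block rows\<close>

lemma kronecker_append_cols:
  fixes A B :: "'a :: semiring_0 mat"
  assumes A: "A \<in> carrier_mat r n" and B: "B \<in> carrier_mat r n'"
    and C: "C \<in> carrier_mat r' c'"
  shows "kronecker (append_cols A B) C = append_cols (kronecker A C) (kronecker B C)"
proof (rule eq_matI)
  fix i j
  assume "i < dim_row (append_cols (kronecker A C) (kronecker B C))"
    "j < dim_col (append_cols (kronecker A C) (kronecker B C))"
  then have i: "i < r * r'" and j: "j < n * c' + n' * c'"
    using A B C by (auto simp: kronecker_def append_cols_def)
  from j have j': "j < (n + n') * c'" by (simp add: algebra_simps)
  note bounds = div_mod_less[OF i] div_mod_less[OF j']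
  have c: "c' > 0" using bounds by simp
  have split: "j div c' < n \<longleftrightarrow> j < n * c'" using c by (simp add: div_less_iff_less_mult)
  have high: "(j - n * c') div c' = j div c' - n \<and> (j - n * c') mod c' = j mod c'"
    if "\<not> j < n * c'"
  proof -
    obtain t where "j = n * c' + t" using \<open>\<not> j < n * c'\<close> by (metis le_Suc_ex not_less)
    then show ?thesis using c by simp
  qed
  show "kronecker (append_cols A B) C $$ (i, j) =
      append_cols (kronecker A C) (kronecker B C) $$ (i, j)"
    using A B C i j j' bounds split high by (auto simp: kronecker_def append_cols_def)
qed (use A B C in \<open>auto simp: kronecker_def append_cols_def algebra_simps\<close>)

lemma append_cols_inject:
  assumes A: "A \<in> carrier_mat r n" and A': "A' \<in> carrier_mat r n"
    and B: "B \<in> carrier_mat r n'" and B': "B' \<in> carrier_mat r n'"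
    and eq: "append_cols A B = append_cols A' B'"
  shows "A = A' \<and> B = B'"
proof
  have entry: "append_cols A B $$ (i, j) = append_cols A' B' $$ (i, j)" for i j
    by (simp only: eq)
  show "A = A'"
  proof (rule eq_matI)
    fix i j assume "i < dim_row A'" "j < dim_col A'"
    then show "A $$ (i, j) = A' $$ (i, j)"
      using entry[of i j] A A' B B' by (simp add: append_cols_def)
  qed (use A A' in auto)
  show "B = B'"
  proof (rule eq_matI)
    fix i j assume "i < dim_row B'" "j < dim_col B'"
    then show "B $$ (i, j) = B' $$ (i, j)"
      using entry[of i "n + j"] A A' B B' by (simp add: append_cols_def)
  qed (use B B' in auto)
qed

text \<open>Tensoring a column with the identity lets its entries act as scalars on whole blocks; this is
  how the block row of a linearization reproduces the matrix polynomial. The column is reversed to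
  match the descending order of the blocks.\<close>

lemma block_row_desc_mult_kronecker:
  fixes M :: "nat \<Rightarrow> 'a :: comm_semiring_1 mat"
  shows "block_row_desc p m n M * kronecker (mat n 1 (\<lambda>(i, _). v (n - 1 - i))) (1\<^sub>m m) =
     mat p m (\<lambda>(r, s). \<Sum>i<n. M i $$ (r, s) * v i)"
    (is "?B * ?K = ?R")
proof (rule eq_matI)
  fix r s assume "r < dim_row ?R" "s < dim_col ?R"
  then have r: "r < p" and s: "s < m" by auto
  have "(?B * ?K) $$ (r, s) = (\<Sum>l<n * m. M (n - 1 - l div m) $$ (r, l mod m) *
            (v (n - 1 - l div m) * (1\<^sub>m m $$ (l mod m, s))))"
    using r s
    by (simp add: block_row_desc_def kronecker_def scalar_prod_def atLeast0LessThan less_mult_imp_div_less)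
  also have "\<dots> = (\<Sum>a<n. \<Sum>b<m. M (n - 1 - a) $$ (r, b) * (v (n - 1 - a) * (1\<^sub>m m $$ (b, s))))"
    by (rule sum_div_mod[of "\<lambda>a b. M (n - 1 - a) $$ (r, b) * (v (n - 1 - a) * (1\<^sub>m m $$ (b, s)))"])
  also have "\<dots> = (\<Sum>a<n. M (n - 1 - a) $$ (r, s) * v (n - 1 - a))"
  proof (rule sum.cong[OF refl])
    fix a
    have "(\<Sum>b<m. M (n - 1 - a) $$ (r, b) * (v (n - 1 - a) * (1\<^sub>m m $$ (b, s)))) =
      (\<Sum>b<m. if b = s then M (n - 1 - a) $$ (r, b) * v (n - 1 - a) else 0)"
      by (rule sum.cong) (use s in auto)
    then show "(\<Sum>b<m. M (n - 1 - a) $$ (r, b) * (v (n - 1 - a) * (1\<^sub>m m $$ (b, s)))) =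
      M (n - 1 - a) $$ (r, s) * v (n - 1 - a)"
      using s by simp
  qed
  also have "\<dots> = (\<Sum>i<n. M i $$ (r, s) * v i)"
    using sum.nat_diff_reindex[of "\<lambda>i. M i $$ (r, s) * v i" n] by simp
  finally show "(?B * ?K) $$ (r, s) = ?R $$ (r, s)"
    using r s by simp
qed (auto simp: block_row_desc_def kronecker_def)

lemma block_row_desc_Suc:
  fixes M :: "nat \<Rightarrow> 'a :: zero mat"
  assumes "M 0 \<in> carrier_mat p m"
  shows "block_row_desc p m (Suc n) M = append_cols (block_row_desc p m n (\<lambda>i. M (Suc i))) (M 0)"
proof (rule eq_matI)
  fix i j
  assume "i < dim_row (append_cols (block_row_desc p m n (\<lambda>i. M (Suc i))) (M 0))"
    "j < dim_col (append_cols (block_row_desc p m n (\<lambda>i. M (Suc i))) (M 0))"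
  then have i: "i < p" and j: "j < n * m + m"
    using assms by (auto simp: block_row_desc_def append_cols_def)
  show "block_row_desc p m (Suc n) M $$ (i, j) =
      append_cols (block_row_desc p m n (\<lambda>i. M (Suc i))) (M 0) $$ (i, j)"
  proof (cases "j < n * m")
    case True
    then have "Suc (n - Suc (j div m)) = n - j div m"
      by (simp add: less_mult_imp_div_less Suc_diff_Suc)
    with True i j assms show ?thesis by (simp add: block_row_desc_def append_cols_def)
  next
    case False
    then obtain t where t: "j = n * m + t" by (metis le_Suc_ex not_less)
    with j have "t < m" by simp
    with t i assms show ?thesis by (simp add: block_row_desc_def append_cols_def)
  qed
qed (use assms in \<open>auto simp: block_row_desc_def append_cols_def\<close>)

lemma append_rows_append_cols:
  assumes "A \<in> carrier_mat r n" "B \<in> carrier_mat r m" "C \<in> carrier_mat s n" "D \<in> carrier_mat s m"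
  shows "append_rows (append_cols A B) (append_cols C D) = four_block_mat A B C D"
  by (rule eq_matI) (use assms in \<open>auto simp: append_rows_def append_cols_def\<close>)

section \<open>Full row rank and unimodularity\<close>

text \<open>The rank counts a maximal independent set of columns. If there are \<open>n\<close> of them, they form an
  invertible square matrix, whose transpose has trivial kernel.\<close>

lemma (in vec_space) full_row_rank_orthogonal_cols:
  assumes A: "A \<in> carrier_mat n nc" and full: "rank A = n"
    and w: "w \<in> carrier_vec n" and orth: "\<And>c. c \<in> set (cols A) \<Longrightarrow> c \<bullet> w = 0"
  shows "w = 0\<^sub>v n"
proof (rule ccontr)
  assume nz: "w \<noteq> 0\<^sub>v n"
  let ?P = "\<lambda>T. T \<subseteq> set (cols A) \<and> lin_indpt T"
  have "\<exists>S. finite S \<and> maximal S ?P \<and> {} \<subseteq> S"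
    by (rule maximal_exists_superset[of "set (cols A)"])
       (auto simp: lin_dep_def)
  then obtain S where fin: "finite S" and max: "maximal S ?P" by blast
  have S: "S \<subseteq> set (cols A)" "lin_indpt S" using max by (auto simp: maximal_def)
  have card: "card S = n" using rank_card_indpt[OF A max] full by simp
  obtain ss where ss: "set ss = S" "distinct ss" using finite_distinct_list[OF fin] by blast
  have len: "length ss = n" using ss card distinct_card by fastforce
  have carrier: "set ss \<subseteq> carrier_vec n" using S ss A cols_dim[of A] by auto
  define M where "M = mat_of_cols n ss"
  have M: "M \<in> carrier_mat n n" unfolding M_def using len mat_of_cols_carrier(1)[of n ss] by simp
  have cols: "cols M = ss" unfolding M_def using carrier by (rule cols_mat_of_cols)
  have "rank M = n" using lin_indpt_full_rank[OF M] cols ss S by simp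
  then have det: "det M\<^sup>T \<noteq> 0" using det_rank_iff[OF M] det_transpose[OF M] by simp
  have "M\<^sup>T *\<^sub>v w = 0\<^sub>v n"
  proof (rule eq_vecI)
    fix i assume i: "i < dim_vec (0\<^sub>v n :: 'a vec)"
    have "col M i \<in> set (cols A)"
      using i cols S ss M len by (metis cols_nth carrier_matD(2) index_zero_vec(2) nth_mem subsetD)
    then show "(M\<^sup>T *\<^sub>v w) $ i = 0\<^sub>v n $ i" using i M orth by simp
  qed (use M in auto)
  then show False
    using det w nz det_0_iff_vec_prod_zero_field[of "M\<^sup>T" n] M by auto
qed

text \<open>Embedding the coefficients and inserting the point form a single ring homomorphism, which can
  then be applied entrywise to matrices and commutes with their determinants.\<close>

definition eval_ac :: "'a :: field alg_closure \<Rightarrow> 'a poly \<Rightarrow> 'a alg_closure" where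
  "eval_ac z f = poly (map_poly to_ac f) z"

lemma eval_ac_hom: "comm_ring_hom (eval_ac z)"
proof -
  interpret to_ac: comm_ring_hom to_ac by unfold_locales auto
  interpret map_poly_comm_ring_hom to_ac ..
  show ?thesis
    by unfold_locales (auto simp: eval_ac_def hom_distribs)
qed

lemma nonzero_constant_if_no_root:
  fixes f :: "'a :: field poly"
  assumes "\<And>z. eval_ac z f \<noteq> 0"
  shows "\<exists>c. c \<noteq> 0 \<and> f = [:c:]"
proof -
  have "\<not> Polynomial.degree (map_poly to_ac f) > 0"
    using assms alg_closed_imp_poly_has_root unfolding eval_ac_def by blast
  moreover have "Polynomial.degree (map_poly to_ac f) = Polynomial.degree f"
    by (rule degree_map_poly) auto
  ultimately have "Polynomial.degree f = 0" by simp
  then obtain c where "f = [:c:]" by (rule degree_eq_zeroE)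
  moreover from this have "c \<noteq> 0" using assms[of 0] by (auto simp: eval_ac_def)
  ultimately show ?thesis by blast
qed

lemma pencil_index:
  assumes "A \<in> carrier_mat r c" "B \<in> carrier_mat r c" "i < r" "j < c"
  shows "pencil A B $$ (i, j) = [:A $$ (i, j), - B $$ (i, j):]"
  using assms by (simp add: pencil_def)

lemma pencil_carrier:
  assumes "A \<in> carrier_mat r c" "B \<in> carrier_mat r c"
  shows "pencil A B \<in> carrier_mat r c"
  using assms by (auto simp: pencil_def)

lemma eval_pencil_entry: "eval_ac z [:a, - b:] = to_ac a - z * to_ac b"
  by (cases "b = 0"; cases "a = 0") (simp_all add: eval_ac_def map_poly_pCons)

text \<open>When the last column is a polynomial combination of the others, \<open>L(z)\<close> and its leading square
  block have the same column space at every \<open>z\<close>; full row rank of \<open>L(z)\<close> for all \<open>z\<close> therefore makes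
  the leading block invertible everywhere. The argument is dual: a vector orthogonal to the columns
  of \<open>L1(z)\<close> is orthogonal to every column of \<open>L(z)\<close>.\<close>

lemma det_leading_block_constant:
  fixes L1 l v :: "'a :: field poly mat"
  assumes X: "X \<in> carrier_mat n (n + 1)" and Y: "Y \<in> carrier_mat n (n + 1)"
    and L1: "L1 \<in> carrier_mat n n" and l: "l \<in> carrier_mat n 1" and v: "v \<in> carrier_mat n 1"
    and split: "pencil X Y = append_cols L1 l"
    and dep: "l = - (L1 * v)"
    and rank: "\<And>z :: 'a alg_closure.
           vec_space.rank n (map_mat to_ac X - z \<cdot>\<^sub>m map_mat to_ac Y) = n"
  shows "\<exists>c. c \<noteq> 0 \<and> det L1 = [:c:]"
proof (rule nonzero_constant_if_no_root)
  fix z :: "'a alg_closure"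
  interpret ev: comm_ring_hom "eval_ac z" by (rule eval_ac_hom)
  interpret V: vec_space "TYPE('a alg_closure)" n .
  let ?L1 = "map_mat (eval_ac z) L1" and ?v = "map_mat (eval_ac z) v"
  let ?L = "map_mat to_ac X - z \<cdot>\<^sub>m map_mat to_ac Y"
  have L: "?L \<in> carrier_mat n (n + 1)" using X Y by auto
  have entry: "?L $$ (i, j) = eval_ac z (append_cols L1 l $$ (i, j))" if "i < n" "j < n + 1" for i j
    using that X Y by (simp add: split[symmetric] pencil_index[OF X Y] eval_pencil_entry)
  have left: "col ?L j = col ?L1 j" if "j < n" for j
    by (rule eq_vecI) (use that X Y L1 l in \<open>simp_all del: index_minus_mat(1) add: entry append_cols_def\<close>)
  have last: "col ?L n = - (?L1 *\<^sub>v col ?v 0)"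
  proof (rule eq_vecI)
    fix i assume "i < dim_vec (- (?L1 *\<^sub>v col ?v 0))"
    then have i: "i < n" using L1 by simp
    have "?L $$ (i, n) = eval_ac z (- (L1 * v) $$ (i, 0))"
      using i L1 l v by (simp del: index_minus_mat(1) add: entry append_cols_def dep)
    also have "\<dots> = - (map_mat (eval_ac z) (L1 * v) $$ (i, 0))"
      using i L1 v by (simp add: ev.hom_uminus)
    also have "\<dots> = - ((?L1 * ?v) $$ (i, 0))"
      by (simp add: ev.mat_hom_mult[OF L1 v])
    also have "\<dots> = (- (?L1 *\<^sub>v col ?v 0)) $ i"
      using i L1 v by simp
    finally show "col ?L n $ i = (- (?L1 *\<^sub>v col ?v 0)) $ i"
      using i X Y by simp
  qed (use L1 X Y in simp)
  show "eval_ac z (det L1) \<noteq> 0"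
  proof
    assume "eval_ac z (det L1) = 0"
    then have "det ?L1\<^sup>T = 0" using L1 by (simp add: det_transpose[of _ n])
    then obtain w where w: "w \<in> carrier_vec n" "w \<noteq> 0\<^sub>v n" and ker: "?L1\<^sup>T *\<^sub>v w = 0\<^sub>v n"
      using det_0_iff_vec_prod_zero_field[of "?L1\<^sup>T" n] L1 by auto
    have orth1: "col ?L1 j \<bullet> w = 0" if "j < n" for j
    proof -
      have "(?L1\<^sup>T *\<^sub>v w) $ j = 0" using ker that by simp
      then show ?thesis using that L1 by simp
    qed
    have orth2: "(?L1 *\<^sub>v col ?v 0) \<bullet> w = 0"
    proof -
      have "w \<bullet> (?L1 *\<^sub>v col ?v 0) = (?L1\<^sup>T *\<^sub>v w) \<bullet> col ?v 0"
        by (rule transpose_vec_mult_scalar[symmetric, of _ n n])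
           (use L1 w(1) v in \<open>auto intro!: carrier_vecI\<close>)
      also have "\<dots> = 0"
        unfolding ker by (rule scalar_prod_left_zero) (use v in \<open>auto intro!: carrier_vecI\<close>)
      finally show ?thesis using w(1) L1 v by (subst comm_scalar_prod[of _ n]) auto
    qed
    have "w = 0\<^sub>v n"
    proof (rule V.full_row_rank_orthogonal_cols[OF L rank w(1)])
      fix c assume "c \<in> set (cols ?L)"
      then obtain j where j: "j < n + 1" and c: "c = col ?L j"
        using L by (auto simp: cols_def)
      show "c \<bullet> w = 0"
      proof (cases "j < n")
        case True
        then show ?thesis using c left orth1 by simp
      next
        case False
        then have "c = - (?L1 *\<^sub>v col ?v 0)" using j c last by (simp add: less_Suc_eq)
        then show ?thesis using orth2 w(1) L1 by (simp add: uminus_scalar_prod[symmetric, of _ n])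
      qed
    qed
    with w(2) show False ..
  qed
qed

section \<open>Transfer functions\<close>

lemma to_fract_hom: "comm_ring_hom (to_fract :: 'a :: idom \<Rightarrow> 'a fract)"
  by unfold_locales auto

text \<open>Only \<open>A\<^sup>-\<^sup>1 B\<close> enters the Schur complement, and it equals any polynomial \<open>Q\<close> that solves
  \<open>A Q = B\<close>, because \<open>A\<close> is invertible over the rational functions.\<close>

lemma transfer_function_eq_if_solution:
  fixes A B C D Q :: "'a :: field poly mat"
  assumes A: "A \<in> carrier_mat n n" and C: "C \<in> carrier_mat p n" and D: "D \<in> carrier_mat p m"
    and Q: "Q \<in> carrier_mat n m" and B: "B = A * Q" and det: "det A \<noteq> 0"
  shows "transfer_function A B C D = rat_mat (D + C * Q)"
proof -
  interpret fr: comm_ring_hom "to_fract :: 'a poly \<Rightarrow> _" by (rule to_fract_hom)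
  have rA: "rat_mat A \<in> carrier_mat n n" using A by simp
  have "det (rat_mat A) \<noteq> 0" using det by simp
  then have "rat_mat A \<in> Units (ring_mat TYPE('a poly fract) n ())"
    by (rule det_non_zero_imp_unit[OF rA])
  then obtain R where R: "mat_inverse (rat_mat A) = Some R"
    using mat_inverse(1)[OF rA, of "()"] by (cases "mat_inverse (rat_mat A)") auto
  note inv = mat_inverse(2)[OF rA R]
  have "R * rat_mat B = R * rat_mat A * rat_mat Q"
    unfolding B fr.mat_hom_mult[OF A Q]
    by (rule assoc_mult_mat[symmetric, of _ n n _ n _ m]) (use inv rA Q in auto)
  then have RB: "R * rat_mat B = rat_mat Q" using inv Q by (simp add: left_mult_one_mat[of _ n m])
  have "rat_mat C * R * rat_mat B = rat_mat C * (R * rat_mat B)"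
    by (rule assoc_mult_mat[of _ p n _ n _ m]) (use inv C A B Q in auto)
  also have "\<dots> = rat_mat (C * Q)" unfolding RB fr.mat_hom_mult[OF C Q] ..
  finally show ?thesis
    unfolding transfer_function_def R using C D Q by (auto intro!: eq_matI)
qed

section \<open>The linearization\<close>

theorem theorem5p1:
  fixes A B :: "nat \<Rightarrow> 'a :: field mat"
    and q :: "nat \<Rightarrow> 'a poly"
    and X Y :: "'a mat"
    and P C X1 X2 :: "'a poly mat"
    and k p m :: nat
  assumes "k \<ge> 1"
    and "\<And>i. i < k \<Longrightarrow> A i \<in> carrier_mat p m"
    and "\<And>i. i < k \<Longrightarrow> B i \<in> carrier_mat p m"
    and "q 0 = 1"
    and "P = mat p m (\<lambda>(r, s). \<Sum>i<k. pencil (A i) (B i) $$ (r, s) * q i)"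
    and "X \<in> carrier_mat (k - 1) k"
    and "Y \<in> carrier_mat (k - 1) k"
    and "pencil X Y *\<^sub>v vec k (\<lambda>i. q (k - 1 - i)) = 0\<^sub>v (k - 1)"
    and "\<And>z :: 'a alg_closure.
           vec_space.rank (k - 1) (map_mat to_ac X - z \<cdot>\<^sub>m map_mat to_ac Y) = k - 1"
    and "C = append_rows (block_row_desc p m k (\<lambda>i. pencil (A i) (B i)))
                         (kronecker (pencil X Y) (1\<^sub>m m))"
    and "kronecker (pencil X Y) (1\<^sub>m m) = append_cols X1 X2"
    and "X1 \<in> carrier_mat ((k - 1) * m) ((k - 1) * m)"
    and "X2 \<in> carrier_mat ((k - 1) * m) m"
  defines "N \<equiv> block_row_desc p m (k - 1) (\<lambda>i. pencil (A (Suc i)) (B (Suc i)))"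
    and "D \<equiv> pencil (A 0) (B 0)"
  shows "C = four_block_mat N D X1 X2 \<and>
         linear_system_matrix C X1 X2 (- N) D \<and>
         transfer_function X1 X2 (- N) D = rat_mat P \<and>
         unimodular_poly_mat X1"
proof -
  obtain n where k: "k = Suc n" using assms(1) by (cases k) auto
  note AB = assms(2,3)[unfolded k]
  note X = assms(6)[unfolded k, simplified] and Y = assms(7)[unfolded k, simplified]
  note X1 = assms(12)[unfolded k, simplified] and X2 = assms(13)[unfolded k, simplified]
  let ?L = "pencil X Y"
  have L: "?L \<in> carrier_mat n (Suc n)" by (rule pencil_carrier[OF X Y])
  define L1 where "L1 = mat n n (\<lambda>(i, j). ?L $$ (i, j))"
  define l where "l = mat n 1 (\<lambda>(i, _). ?L $$ (i, n))"
  define v where "v = mat n 1 (\<lambda>(i, _). q (Suc (n - 1 - i)))"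
  have L1: "L1 \<in> carrier_mat n n" and l: "l \<in> carrier_mat n 1" and v: "v \<in> carrier_mat n 1"
    by (auto simp: L1_def l_def v_def)
  have split: "?L = append_cols L1 l"
    by (rule eq_matI) (use L in \<open>auto simp: append_cols_def L1_def l_def less_Suc_eq\<close>)

  (* Each row of the null vector relation with its last summand isolated; the coefficient is q 0 = 1. *)
  have dep: "l = - (L1 * v)"
  proof (rule eq_matI)
    fix i j assume "i < dim_row (- (L1 * v))" "j < dim_col (- (L1 * v))"
    then have i: "i < n" and j: "j = 0" using L1 v by auto
    have "(\<Sum>j<Suc n. ?L $$ (i, j) * q (n - j)) = (?L *\<^sub>v vec k (\<lambda>i. q (k - 1 - i))) $ i"
      using i L by (simp add: k scalar_prod_def atLeast0LessThan)
    also have "\<dots> = 0" using i assms(8) k by simp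
    finally have "l $$ (i, 0) = - (\<Sum>j<n. ?L $$ (i, j) * q (n - j))"
      using i assms(4) by (simp add: l_def add_eq_0_iff2 add.commute)
    also have "(\<Sum>j<n. ?L $$ (i, j) * q (n - j)) = (L1 * v) $$ (i, 0)"
      using i by (simp add: L1_def v_def scalar_prod_def atLeast0LessThan Suc_diff_Suc)
    finally show "l $$ (i, j) = (- (L1 * v)) $$ (i, j)" using i j L1 v by simp
  qed (use L1 l v in auto)

  have "append_cols X1 X2 = append_cols (kronecker L1 (1\<^sub>m m)) (kronecker l (1\<^sub>m m))"
    using assms(11) kronecker_append_cols[OF L1 l one_carrier_mat, of m] split by simp
  moreover have "kronecker l (1\<^sub>m m) \<in> carrier_mat (n * m) m"
    using kronecker_carrier[OF l one_carrier_mat, of m] by simp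
  ultimately have X1_eq: "X1 = kronecker L1 (1\<^sub>m m)" and X2_eq: "X2 = kronecker l (1\<^sub>m m)"
    using append_cols_inject[OF X1 kronecker_carrier[OF L1 one_carrier_mat] X2] by auto

  define Q where "Q = kronecker v (1\<^sub>m m)"
  have Q: "Q \<in> carrier_mat (n * m) m"
    using kronecker_carrier[OF v one_carrier_mat, of m] by (simp add: Q_def)
  have X1Q: "X1 * Q = - X2"
  proof -
    have "X1 * Q = kronecker (- l) (1\<^sub>m m)"
      unfolding X1_eq Q_def dep
      using kronecker_mult[OF L1 one_carrier_mat v one_carrier_mat, of m] L1 v by simp
    also have "\<dots> = - X2"
      unfolding X2_eq
      by (rule eq_matI) (use l in \<open>auto simp: kronecker_def less_mult_imp_div_less\<close>)
    finally show ?thesis .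
  qed
  (* The solution is -Q, and the transfer function is formed with -N: the two signs cancel. *)
  have X2_Q: "X2 = X1 * (- Q)"
    using X1Q X1 Q X2 by (metis uminus_mult_right_mat uminus_uminus_mat carrier_matD)

  obtain c where c: "c \<noteq> 0" "det L1 = [:c:]"
    using det_leading_block_constant[OF _ _ L1 l v split dep] X Y assms(9) k by auto
  have "det X1 dvd [:c:] ^ (n * m)"
    using det_kronecker_one_dvd[OF L1, of m] c(2) X1_eq by simp
  also have "[:c:] ^ (n * m) dvd 1"
    using c(1) by (intro is_unit_power_iff[THEN iffD2] disjI1) (simp add: is_unit_const_poly_iff dvd_field_iff)
  finally have unit: "det X1 dvd 1" .
  then obtain d where d: "det X1 = [:d:]" "d \<noteq> 0"
    by (metis is_unit_poly_iff dvd_field_iff zero_neq_one)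
  have uni: "unimodular_poly_mat X1"
    using d X1 by (auto simp: unimodular_poly_mat_def)
  have det: "det X1 \<noteq> 0" using unit by auto

  have D: "D \<in> carrier_mat p m" unfolding D_def using AB by (intro pencil_carrier) auto
  have N: "N \<in> carrier_mat p (n * m)" by (simp add: N_def block_row_desc_def k)
  have blocks: "C = four_block_mat N D X1 X2"
    unfolding assms(10,11) k
    using block_row_desc_Suc[of "\<lambda>i. pencil (A i) (B i)" p m n]
      append_rows_append_cols[OF N D X1 X2] D
    by (simp add: N_def D_def k)

  let ?R = "block_row_desc p m k (\<lambda>i. pencil (A i) (B i))"
  have degR: "Polynomial.degree (?R $$ (i, j)) \<le> 1" if "i < p" "j < Suc n * m" for i j
    using that div_mod_less[OF that(2)]
    by (simp add: k block_row_desc_def pencil_index[OF AB])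
  have degL: "Polynomial.degree (kronecker ?L (1\<^sub>m m) $$ (i, j)) \<le> 1"
    if "i < n * m" "j < Suc n * m" for i j
    using div_mod_less[OF that(1)] div_mod_less[OF that(2)] that L
    by (simp add: kronecker_def pencil_index[OF X Y])
  have pencil: "is_pencil C"
    unfolding is_pencil_def assms(10)
    using degR degL L by (auto simp: append_rows_def k block_row_desc_def kronecker_def)

  have "D + N * Q = P"
  proof -
    have NQ: "N * Q = mat p m (\<lambda>(r, s). \<Sum>i<n. pencil (A (Suc i)) (B (Suc i)) $$ (r, s) * q (Suc i))"
      unfolding N_def Q_def v_def k
      using block_row_desc_mult_kronecker[of p m n "\<lambda>i. pencil (A (Suc i)) (B (Suc i))" "\<lambda>i. q (Suc i)"]
      by simp
    show ?thesis unfolding NQ assms(5) k sum.lessThan_Suc_shift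
      by (rule eq_matI) (use D assms(4) in \<open>auto simp: D_def\<close>)
  qed
  moreover have "(- N) * (- Q) = N * Q" using N Q by auto
  ultimately have "transfer_function X1 X2 (- N) D = rat_mat P"
    using transfer_function_eq_if_solution[OF X1 _ D _ X2_Q det, of "- N"] N Q by simp
  moreover have "linear_system_matrix C X1 X2 (- N) D"
    unfolding linear_system_matrix_def poly_system_matrix_def regular_poly_mat_def
    using pencil blocks det X1 X2 N D by auto
  ultimately show ?thesis using blocks uni by blast
qed

end
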